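(* In the setting described in the context, for each $\varepsilon$ with $0\le\varepsilon\le 1-E_{\min}$, $$\langle \omega_\varepsilon(\mathcal S)\rangle_{\mathcal S}=\int_{\mathcal W_\varepsilon}(1-E(w))^n\,dw=\int_{E_{\min}+\varepsilon}^1(1-E)^nD(E)\,dE\le \Omega_\varepsilon\,\bigl(1-(E_{\min}+\varepsilon)\bigr)^n .$$
   Context: Setting. $P(x,y)=P(y\mid x)P(x)$ is a probability distribution on pairs (input $x$, label $y$). $\mathcal W\subseteq\mathbb R^N$ is a compact set of non-zero Lebesgue measure; each $w\in\mathcal W$ determines a classifier function $h_w$ assigning a class label to each input, and $\mathcal H_{\mathcal W}=\{h_w: w\in\mathcal W\}$ is assumed to have a (large but) finite VC-dimension. The loss is $L(y,h_w(x))\in\{0,1\}$, equal to $0$ if the classification is correct and $1$ if it is incorrect. The true error of $w$ is $E(w)=\int L(y,h_w(x))\,P(x,y)\,dx\,dy\in[0,1]$; $E(w)$ is assumed to be integrable on $\mathcal W$, and $E_{\min}=\min_{w\in\mathcal W}E(w)$ denotes the minimum true error. Training sets. $\mathcal S=\{(x_1,y_1),\dots,(x_n,y_n)\}$ is a training set of $n$ samples drawn i.i.d. from $P(x,y)$, i.e. $\mathcal S$ is drawn from $P(x,y)^n$. The training error is $E_{\mathcal S}(w)=\frac1n\sum_{i=1}^nL(y_i,h_w(x_i))$. $\langle\cdot\rangle_{\mathcal S}$ denotes the mean over random $\mathcal S$. Parameter sets and volumes, for $\varepsilon\ge0$: $\mathcal W_\varepsilon=\{w\in\mathcal W:E(w)\ge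 E_{\min}+\varepsilon\}$; $\mathcal W(\mathcal S)=\{w\in\mathcal W:E_{\mathcal S}(w)=0\}$; $\mathcal W_\varepsilon(\mathcal S)=\{w\in\mathcal W_\varepsilon:E_{\mathcal S}(w)=0\}$ (the "bad" global minima of the training error). With $|\cdot|$ denoting volume, $\Omega_\varepsilon=|\mathcal W_\varepsilon|$ and $\omega_\varepsilon(\mathcal S)=|\mathcal W_\varepsilon(\mathcal S)|$; for random $\mathcal S$, $\omega_\varepsilon(\mathcal S)$ is a random variable. Over-parameterization assumption: $\mathcal W(\mathcal S)$ has non-zero measure for almost all $\mathcal S$ with $|\mathcal S|=n$. Density of classifiers. $D(E)$ is defined such that $\Omega_\varepsilon=\int_{E_{\min}+\varepsilon}^1D(E)\,dE$ for each $0\le\varepsilon\le1-E_{\min}$, with $D(E)=0$ for $0\le E<E_{\min}$; $D(E)\,dE$ is the volume of parameters $w\in\mathcal W$ with $E\le E(w)\le E+dE$. The density may be a generalized one: $D$ may contain point masses (for instance, for a binary problem with random equiprobable labels, $E(w)=0.5$ for all $w$ and $D$ is a peak at $E=0.5$), and the integrals from $E_{\min}+\varepsilon$ to $1$ include a point mass located at an endpoint. *)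

theory Defs
  imports "HOL-Probability.Probability" "HOL-Library.Extended_Nat"
begin

text \<open>
  For an arbitrary label type, shattering is taken with respect to a reference labelling \<open>f\<close>: every
  pattern of correct and incorrect answers (relative to \<open>f\<close>) on \<open>A\<close> is realised by some member of
  the class. For binary labels this is the usual Vapnik-Chervonenkis notion, as shown below.
\<close>

definition shatters :: "('x \<Rightarrow> 'y) set \<Rightarrow> 'x set \<Rightarrow> bool" where
  "shatters H A \<longleftrightarrow> (\<exists>f. \<forall>B\<subseteq>A. \<exists>h\<in>H. \<forall>x\<in>A. h x = f x \<longleftrightarrow> x \<in> B)"

lemma shatters_bool_iff:
  fixes H :: "('x \<Rightarrow> bool) set"
  shows "shatters H A \<longleftrightarrow> (\<forall>B\<subseteq>A. \<exists>h\<in>H. {x\<in>A. h x} = B)"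
proof
  assume "shatters H A"
  then obtain f where f: "\<And>B. B \<subseteq> A \<Longrightarrow> \<exists>h\<in>H. \<forall>x\<in>A. h x = f x \<longleftrightarrow> x \<in> B"
    unfolding shatters_def by blast
  show "\<forall>B\<subseteq>A. \<exists>h\<in>H. {x\<in>A. h x} = B"
  proof (intro allI impI)
    fix B assume B: "B \<subseteq> A"
    obtain h where "h \<in> H" and h: "\<forall>x\<in>A. h x = f x \<longleftrightarrow> x \<in> {x\<in>A. f x \<longleftrightarrow> x \<in> B}"
      using f[of "{x\<in>A. f x \<longleftrightarrow> x \<in> B}"] by blast
    have "{x\<in>A. h x} = B" using h B by blast
    with \<open>h \<in> H\<close> show "\<exists>h\<in>H. {x\<in>A. h x} = B" by blast
  qed
next
  assume H: "\<forall>B\<subseteq>A. \<exists>h\<in>H. {x\<in>A. h x} = B"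
  have "\<forall>B\<subseteq>A. \<exists>h\<in>H. \<forall>x\<in>A. h x = True \<longleftrightarrow> x \<in> B"
    using H by blast
  then show "shatters H A"
    unfolding shatters_def by (intro exI[of _ "\<lambda>_. True"])
qed

definition vc_dim :: "('x \<Rightarrow> 'y) set \<Rightarrow> enat" where
  "vc_dim H = (SUP A\<in>{A. finite A \<and> shatters H A}. enat (card A))"

definition loss :: "'y \<Rightarrow> 'y \<Rightarrow> real" where
  "loss y y' = (if y' = y then 0 else 1)"

definition true_error :: "('x \<times> 'y) measure \<Rightarrow> ('w \<Rightarrow> 'x \<Rightarrow> 'y) \<Rightarrow> 'w \<Rightarrow> real" where
  "true_error P h w = (\<integral>(x, y). loss y (h w x) \<partial>P)"

text \<open>The infimum is the minimum exactly when it belongs to \<open>true_error P h ` W\<close>.\<close>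

definition min_error :: "('x \<times> 'y) measure \<Rightarrow> 'w set \<Rightarrow> ('w \<Rightarrow> 'x \<Rightarrow> 'y) \<Rightarrow> real" where
  "min_error P W h = (INF w\<in>W. true_error P h w)"

text \<open>A training set of size \<open>n\<close> is a function \<open>S\<close> on \<open>{..<n}\<close>.\<close>

definition training_error :: "('w \<Rightarrow> 'x \<Rightarrow> 'y) \<Rightarrow> nat \<Rightarrow> (nat \<Rightarrow> 'x \<times> 'y) \<Rightarrow> 'w \<Rightarrow> real" where
  "training_error h n S w = (1 / real n) * (\<Sum>i<n. loss (snd (S i)) (h w (fst (S i))))"

definition training_dist :: "('x \<times> 'y) measure \<Rightarrow> nat \<Rightarrow> (nat \<Rightarrow> 'x \<times> 'y) measure" where
  "training_dist P n = (\<Pi>\<^sub>M i\<in>{..<n}. P)"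

definition bad_params :: "('x \<times> 'y) measure \<Rightarrow> 'w set \<Rightarrow> ('w \<Rightarrow> 'x \<Rightarrow> 'y) \<Rightarrow> real \<Rightarrow> 'w set" where
  "bad_params P W h \<epsilon> = {w\<in>W. true_error P h w \<ge> min_error P W h + \<epsilon>}"

definition global_minima :: "'w set \<Rightarrow> ('w \<Rightarrow> 'x \<Rightarrow> 'y) \<Rightarrow> nat \<Rightarrow> (nat \<Rightarrow> 'x \<times> 'y) \<Rightarrow> 'w set" where
  "global_minima W h n S = {w\<in>W. training_error h n S w = 0}"

definition bad_minima ::
    "('x \<times> 'y) measure \<Rightarrow> 'w set \<Rightarrow> ('w \<Rightarrow> 'x \<Rightarrow> 'y) \<Rightarrow> real \<Rightarrow> nat \<Rightarrow> (nat \<Rightarrow> 'x \<times> 'y) \<Rightarrow> 'w set" where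
  "bad_minima P W h \<epsilon> n S = {w\<in>bad_params P W h \<epsilon>. training_error h n S w = 0}"

definition bad_volume ::
    "('x \<times> 'y) measure \<Rightarrow> 'w::euclidean_space set \<Rightarrow> ('w \<Rightarrow> 'x \<Rightarrow> 'y) \<Rightarrow> real \<Rightarrow> real" where
  "bad_volume P W h \<epsilon> = measure lebesgue (bad_params P W h \<epsilon>)"

definition bad_minima_volume ::
    "('x \<times> 'y) measure \<Rightarrow> 'w::euclidean_space set \<Rightarrow> ('w \<Rightarrow> 'x \<Rightarrow> 'y) \<Rightarrow> real \<Rightarrow> nat \<Rightarrow>
     (nat \<Rightarrow> 'x \<times> 'y) \<Rightarrow> real" where
  "bad_minima_volume P W h \<epsilon> n S = measure lebesgue (bad_minima P W h \<epsilon> n S)"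

text \<open>
  Since the density of classifiers may contain point masses, it is represented by the measure
  \<open>D(E) dE\<close> on the Borel sets of the line. An ordinary density function \<open>d\<close> corresponds to
  \<open>density lborel d\<close>. The intervals are closed, so a point mass at an endpoint counts.
\<close>

definition classifier_density ::
    "('x \<times> 'y) measure \<Rightarrow> 'w::euclidean_space set \<Rightarrow> ('w \<Rightarrow> 'x \<Rightarrow> 'y) \<Rightarrow> real measure \<Rightarrow> bool" where
  "classifier_density P W h D \<longleftrightarrow>
     sets D = sets borel \<and>
     (\<forall>\<epsilon>. 0 \<le> \<epsilon> \<and> \<epsilon> \<le> 1 - min_error P W h \<longrightarrow>
        emeasure D {min_error P W h + \<epsilon>..1} = ennreal (bad_volume P W h \<epsilon>)) \<and>
     emeasure D {0..<min_error P W h} = 0"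

end

theory Submission
  imports Defs
begin

text \<open>
  A parameter \<open>w\<close> is consistent with \<open>S\<close> iff all \<open>n\<close> independent samples are classified
  correctly, which has probability \<open>(1 - E(w))^n\<close>; exchanging the integrals over \<open>S\<close> and \<open>w\<close>
  gives the first equation. For the second one, the density of classifiers is the image of the
  volume on \<open>W\<close> under the true error, as both measures agree on all the rays \<open>{a..}\<close>.
\<close>

section \<open>Uniqueness of finite Borel measures on the line\<close>

lemma finite_borel_measure_eqI_atLeast:
  fixes M N :: "real measure"
  assumes "sets M = sets borel" "sets N = sets borel" "finite_measure M"
    and eq: "\<And>a. emeasure M {a..} = emeasure N {a..}"
  shows "M = N"
proof (rule measure_eqI_generator_eq)
  let ?G = "range (\<lambda>a::real. {a..})"
  show "Int_stable ?G"
  proof (rule Int_stableI_image)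
    fix i j :: real
    show "\<exists>k\<in>UNIV. {i..} \<inter> {j..} = {k..}"
      by (intro bexI[of _ "max i j"]) auto
  qed
  show "?G \<subseteq> Pow UNIV" by auto
  show "sets M = sigma_sets UNIV ?G" "sets N = sigma_sets UNIV ?G"
    using assms by (simp_all add: borel_Ici)
  \<comment> \<open>These rays exhaust the line and have finite \<open>M\<close>-measure, so
    uniqueness on an intersection-stable generator applies. Finiteness is checked for
    \<open>M\<close> only.\<close>
  show "range (\<lambda>i. {- real i..}) \<subseteq> ?G" by auto
  show "(\<Union>i. {- real i..}) = UNIV"
  proof -
    have "\<exists>i. x \<ge> - real i" for x :: real
      using reals_Archimedean2[of "- x"] by (metis less_eq_real_def minus_le_iff)
    then show ?thesis by auto
  qed
  show "emeasure M {- real i..} \<noteq> \<infinity>" for i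
    using finite_measure.emeasure_finite[OF assms(3)] by simp
qed (auto simp: eq)

section \<open>Zero-one loss and zero training error\<close>

lemma loss_nonneg: "0 \<le> loss y y'" and loss_le_1: "loss y y' \<le> 1"
  by (simp_all add: loss_def)

text \<open>The indicator of consistency with \<open>S\<close> is written as a product over the
  samples, the form in which independence can be exploited.\<close>

lemma prod_one_minus_loss:
  fixes n :: nat
  shows "(\<Prod>i<n. 1 - loss (snd (S i)) (h w (fst (S i)))) =
     (if \<forall>i<n. h w (fst (S i)) = snd (S i) then 1 else 0)"
  by (auto simp: loss_def intro!: prod.neutral prod_zero)

lemma training_error_eq_0_iff:
  assumes "n \<ge> 1"
  shows "training_error h n S w = 0 \<longleftrightarrow> (\<forall>i<n. h w (fst (S i)) = snd (S i))"
proof -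
  have "training_error h n S w = 0 \<longleftrightarrow> (\<Sum>i<n. loss (snd (S i)) (h w (fst (S i)))) = 0"
    using assms by (simp add: training_error_def)
  also have "\<dots> \<longleftrightarrow> (\<forall>i<n. loss (snd (S i)) (h w (fst (S i))) = 0)"
    by (subst sum_nonneg_eq_0_iff) (auto simp: loss_nonneg)
  also have "\<dots> \<longleftrightarrow> (\<forall>i<n. h w (fst (S i)) = snd (S i))"
    by (auto simp: loss_def)
  finally show ?thesis .
qed

text \<open>Compactness of the parameter set is replaced by finite Lebesgue measure. Measurability
  of the loss is joint in parameter and sample: this makes the true error measurable in
  \<open>w\<close> and permits Fubini.\<close>

locale parametrised_classifier = prob_space P
  for P :: "('x \<times> 'y) measure" +
  fixes W :: "'w::euclidean_space set" and h :: "'w \<Rightarrow> 'x \<Rightarrow> 'y"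
  assumes lmeasurable_W: "W \<in> lmeasurable"
    and nonempty_W: "W \<noteq> {}"
    and measurable_loss: "(\<lambda>(w, (x, y)). loss y (h w x)) \<in> borel_measurable (lebesgue_on W \<Otimes>\<^sub>M P)"
begin

section \<open>Measurability and bounds of the true error\<close>

lemma sets_W [measurable]: "W \<in> sets lebesgue"
  using lmeasurable_W by blast

lemma finite_measure_W: "finite_measure (lebesgue_on W)"
  using lmeasurable_W by (intro finite_measure_lebesgue_on)

lemma measurable_loss':
  "(\<lambda>z. loss (snd (snd z)) (h (fst z) (fst (snd z)))) \<in> borel_measurable (lebesgue_on W \<Otimes>\<^sub>M P)"
  using measurable_loss by (simp add: case_prod_unfold)

lemma measurable_loss_section:
  assumes "w \<in> W"
  shows "(\<lambda>z. loss (snd z) (h w (fst z))) \<in> borel_measurable P"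
proof -
  have "Pair w \<in> measurable P (lebesgue_on W \<Otimes>\<^sub>M P)"
    using assms by (intro measurable_Pair1') simp
  from measurable_comp[OF this measurable_loss'] show ?thesis
    by (simp add: comp_def)
qed

lemma true_error_eq: "true_error P h w = (\<integral>z. loss (snd z) (h w (fst z)) \<partial>P)"
  by (simp add: true_error_def case_prod_unfold)

lemma true_error_nonneg: "0 \<le> true_error P h w"
  unfolding true_error_eq by (intro Bochner_Integration.integral_nonneg) (simp add: loss_nonneg)

lemma integrable_loss_section:
  assumes "w \<in> W"
  shows "integrable P (\<lambda>z. loss (snd z) (h w (fst z)))"
  using measurable_loss_section[OF assms]
  by (intro integrable_const_bound[of _ 1]) (auto simp: loss_def)

lemma true_error_le_1:
  assumes "w \<in> W"
  shows "true_error P h w \<le> 1"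
  unfolding true_error_eq
  by (intro integral_le_const integrable_loss_section assms) (auto simp: loss_le_1)

lemma one_minus_true_error:
  assumes "w \<in> W"
  shows "(\<integral>z. 1 - loss (snd z) (h w (fst z)) \<partial>P) = 1 - true_error P h w"
  using integrable_loss_section[OF assms] by (simp add: true_error_eq prob_space)

lemma measurable_true_error [measurable]: "true_error P h \<in> borel_measurable (lebesgue_on W)"
  unfolding true_error_eq [abs_def]
  using measurable_loss' by (intro borel_measurable_lebesgue_integral) (simp add: case_prod_unfold)

lemma min_error_le:
  assumes "w \<in> W"
  shows "min_error P W h \<le> true_error P h w"
  unfolding min_error_def
  using assms by (intro cINF_lower bdd_belowI2[of _ 0]) (auto simp: true_error_nonneg)

section \<open>Bad parameters and integration over subsets of \<open>W\<close>\<close>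

lemma bad_params_subset: "bad_params P W h \<epsilon> \<subseteq> W"
  by (auto simp: bad_params_def)

lemma sets_bad_params_on: "bad_params P W h \<epsilon> \<in> sets (lebesgue_on W)"
proof -
  have "{w \<in> space (lebesgue_on W). min_error P W h + \<epsilon> \<le> true_error P h w} \<in> sets (lebesgue_on W)"
    by measurable
  then show ?thesis by (simp add: bad_params_def)
qed

lemma emeasure_on_subset: "A \<subseteq> W \<Longrightarrow> emeasure (lebesgue_on W) A = emeasure lebesgue A"
  by (intro emeasure_restrict_space) auto

lemma measure_on_subset: "A \<subseteq> W \<Longrightarrow> measure (lebesgue_on W) A = measure lebesgue A"
  by (simp add: measure_def emeasure_on_subset)

text \<open>Moves set integrals to \<open>lebesgue_on W\<close>, which is a finite measure and on
  which the true error is known to be measurable; outside \<open>W\<close> nothing is known about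
  it.\<close>

lemma set_integral_on_subset:
  fixes f :: "'w \<Rightarrow> real"
  assumes "A \<subseteq> W"
  shows "(LINT w:A|lebesgue. f w) = (\<integral>w. indicator A w * f w \<partial>lebesgue_on W)"
proof -
  have "(\<integral>w. indicator A w * f w \<partial>lebesgue_on W) =
      (\<integral>w. indicator W w *\<^sub>R (indicator A w * f w) \<partial>lebesgue)"
    by (subst integral_restrict_space) (auto simp: set_lebesgue_integral_def)
  also have "\<dots> = (LINT w:A|lebesgue. f w)"
    unfolding set_lebesgue_integral_def
    using assms by (intro Bochner_Integration.integral_cong) (auto simp: indicator_def)
  finally show ?thesis by simp
qed

section \<open>Mean volume of the bad minima\<close>

lemma measurable_consistency:
  "(\<lambda>(S, w). \<Prod>i<n. 1 - loss (snd (S i)) (h w (fst (S i))))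
     \<in> borel_measurable (training_dist P n \<Otimes>\<^sub>M lebesgue_on W)"
proof -
  have "(\<lambda>z. loss (snd (fst z i)) (h (snd z) (fst (fst z i))))
      \<in> borel_measurable (training_dist P n \<Otimes>\<^sub>M lebesgue_on W)" if "i < n" for i
  proof -
    \<comment> \<open>Each factor is the jointly measurable loss composed with the map from
      \<open>(S, w)\<close> to \<open>(w, S i)\<close>.\<close>
    have "(\<lambda>z. (snd z, fst z i)) \<in> measurable (training_dist P n \<Otimes>\<^sub>M lebesgue_on W) (lebesgue_on W \<Otimes>\<^sub>M P)"
      unfolding training_dist_def using that
      by (intro measurable_Pair measurable_snd measurable_compose[OF measurable_fst]
          measurable_component_singleton) simp
    from measurable_comp[OF this measurable_loss'] show ?thesis
      by (simp add: comp_def)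
  qed
  then show ?thesis
    unfolding case_prod_beta by (intro borel_measurable_prod borel_measurable_diff) auto
qed

lemma prob_space_training_dist: "prob_space (training_dist P n)"
  unfolding training_dist_def by (intro prob_space_PiM) (rule prob_space_axioms)

text \<open>By independence the integral of the product splits into \<open>n\<close> equal factors,
  each being the probability \<open>1 - true_error P h w\<close> of a correct answer.\<close>

lemma integral_consistency:
  assumes "w \<in> W"
  shows "(\<integral>S. (\<Prod>i<n. 1 - loss (snd (S i)) (h w (fst (S i)))) \<partial>training_dist P n)
    = (1 - true_error P h w) ^ n"
proof -
  interpret product_sigma_finite "\<lambda>_. P"
    by unfold_locales
  show ?thesis
    unfolding training_dist_def
    using integrable_loss_section[OF assms]
    by (subst product_integral_prod) (simp_all add: one_minus_true_error[OF assms])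
qed

lemma bad_minima_volume_eq:
  assumes "n \<ge> 1" and S: "S \<in> space (training_dist P n)"
  shows "bad_minima_volume P W h \<epsilon> n S = (\<integral>w. indicator (bad_params P W h \<epsilon>) w *
      (\<Prod>i<n. 1 - loss (snd (S i)) (h w (fst (S i)))) \<partial>lebesgue_on W)"
proof -
  let ?c = "\<lambda>w. \<Prod>i<n. 1 - loss (snd (S i)) (h w (fst (S i)))"
  let ?B = "bad_minima P W h \<epsilon> n S"
  have "Pair S \<in> measurable (lebesgue_on W) (training_dist P n \<Otimes>\<^sub>M lebesgue_on W)"
    using S by (rule measurable_Pair1')
  from measurable_comp[OF this measurable_consistency]
  have [measurable]: "?c \<in> borel_measurable (lebesgue_on W)"
    by (simp add: comp_def)
  \<comment> \<open>Zero training error becomes \<open>?c w = 1\<close>. As \<open>?c\<close> is a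
    section of a jointly measurable function, this shows that \<open>?B\<close> is
    measurable.\<close>
  have B: "?B = bad_params P W h \<epsilon> \<inter> {w \<in> space (lebesgue_on W). ?c w = 1}"
    using assms(1) bad_params_subset[of \<epsilon>]
    by (auto simp: bad_minima_def training_error_eq_0_iff prod_one_minus_loss split: if_splits)
  have "{w \<in> space (lebesgue_on W). ?c w = 1} \<in> sets (lebesgue_on W)"
    by measurable
  then have [measurable]: "?B \<in> sets (lebesgue_on W)"
    unfolding B by (intro sets.Int sets_bad_params_on)
  have "bad_minima_volume P W h \<epsilon> n S = measure (lebesgue_on W) ?B"
    unfolding bad_minima_volume_def
    using bad_params_subset[of \<epsilon>] by (intro measure_on_subset[symmetric]) (auto simp: B)
  also have "\<dots> = (\<integral>w. indicator ?B w \<partial>lebesgue_on W)"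
    using sets.sets_into_space[OF \<open>?B \<in> sets (lebesgue_on W)\<close>] by (simp add: Int_absorb2)
  also have "\<dots> = (\<integral>w. indicator (bad_params P W h \<epsilon>) w * ?c w \<partial>lebesgue_on W)"
    by (intro Bochner_Integration.integral_cong refl)
      (auto simp: B indicator_def prod_one_minus_loss)
  finally show ?thesis .
qed

theorem mean_bad_minima_volume:
  assumes "n \<ge> 1"
  shows "(\<integral>S. bad_minima_volume P W h \<epsilon> n S \<partial>training_dist P n)
    = (LINT w:bad_params P W h \<epsilon>|lebesgue. (1 - true_error P h w) ^ n)"
proof -
  let ?A = "bad_params P W h \<epsilon>"
  let ?f = "\<lambda>(S, w). indicator ?A w * (\<Prod>i<n. 1 - loss (snd (S i)) (h w (fst (S i))))"
  interpret T: prob_space "training_dist P n" by (rule prob_space_training_dist)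
  interpret M: finite_measure "lebesgue_on W" by (rule finite_measure_W)
  interpret TM: pair_sigma_finite "training_dist P n" "lebesgue_on W" ..
  interpret TM: finite_measure "training_dist P n \<Otimes>\<^sub>M lebesgue_on W"
    by (intro finite_measure_pair_measure T.finite_measure_axioms M.finite_measure_axioms)
  have f: "?f \<in> borel_measurable (training_dist P n \<Otimes>\<^sub>M lebesgue_on W)"
  proof -
    note [measurable] = sets_bad_params_on
    have "(\<lambda>z. indicator ?A (snd z) :: real) \<in> borel_measurable (training_dist P n \<Otimes>\<^sub>M lebesgue_on W)"
      by measurable
    then show ?thesis
      using measurable_consistency unfolding case_prod_beta by (intro borel_measurable_times) auto
  qed
  \<comment> \<open>The integrand takes only the values 0 and 1 and the product measure is finite,
    so Fubini applies.\<close>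
  have int: "integrable (training_dist P n \<Otimes>\<^sub>M lebesgue_on W) ?f"
    using f by (intro TM.integrable_const_bound[of _ 1])
      (auto simp: prod_one_minus_loss indicator_def)
  have "(\<integral>S. bad_minima_volume P W h \<epsilon> n S \<partial>training_dist P n)
      = (\<integral>S. (\<integral>w. ?f (S, w) \<partial>lebesgue_on W) \<partial>training_dist P n)"
    using assms by (intro Bochner_Integration.integral_cong) (auto simp: bad_minima_volume_eq)
  also have "\<dots> = (\<integral>w. (\<integral>S. ?f (S, w) \<partial>training_dist P n) \<partial>lebesgue_on W)"
    using TM.Fubini_integral[of "\<lambda>S w. ?f (S, w)"] int by simp
  also have "\<dots> = (\<integral>w. indicator ?A w * (1 - true_error P h w) ^ n \<partial>lebesgue_on W)"
    by (intro Bochner_Integration.integral_cong) (auto simp: integral_consistency)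
  also have "\<dots> = (LINT w:?A|lebesgue. (1 - true_error P h w) ^ n)"
    by (rule set_integral_on_subset[OF bad_params_subset, symmetric])
  finally show ?thesis .
qed

section \<open>The density of classifiers as an image measure\<close>

lemma emeasure_distr_true_error:
  assumes "min_error P W h \<le> a"
  shows "emeasure (distr (lebesgue_on W) borel (true_error P h)) {a..}
    = ennreal (bad_volume P W h (a - min_error P W h))"
proof -
  interpret M: finite_measure "lebesgue_on W" by (rule finite_measure_W)
  have "emeasure (distr (lebesgue_on W) borel (true_error P h)) {a..}
      = emeasure (lebesgue_on W) (bad_params P W h (a - min_error P W h))"
    by (subst emeasure_distr) (auto simp: bad_params_def intro!: arg_cong[where f = "emeasure _"])
  then show ?thesis
    by (simp add: M.emeasure_eq_measure bad_volume_def measure_on_subset bad_params_subset)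
qed

text \<open>\<open>classifier_density\<close> leaves the mass of \<open>D\<close> below 0 and above
  1 open, so \<open>D\<close> is first cut down to the interval from the minimum error to 1. Point
  masses are covered because measures, not density functions, are compared.\<close>

lemma classifier_density_eq_distr:
  assumes "classifier_density P W h D"
  shows "distr (lebesgue_on W) borel (true_error P h) = density D (indicator {min_error P W h..1})"
    (is "?\<mu> = ?D")
proof (rule finite_borel_measure_eqI_atLeast)
  let ?m = "min_error P W h"
  have sets_D: "sets D = sets borel"
    and D: "\<And>\<epsilon>. 0 \<le> \<epsilon> \<Longrightarrow> \<epsilon> \<le> 1 - ?m \<Longrightarrow> emeasure D {?m + \<epsilon>..1} = ennreal (bad_volume P W h \<epsilon>)"
    using assms by (auto simp: classifier_density_def)
  show "sets ?\<mu> = sets borel" "sets ?D = sets borel"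
    using sets_D by simp_all
  show "finite_measure ?\<mu>"
    by (intro finite_measure.finite_measure_distr finite_measure_W) measurable
  have m_le_1: "?m \<le> 1"
    using nonempty_W min_error_le true_error_le_1 order_trans by blast
  fix a
  \<comment> \<open>No true error lies below \<open>?m\<close>, so the ray may be started at
    \<open>?m\<close> at the earliest. This keeps the offset \<open>max a ?m - ?m\<close>
    non-negative, as the specification of \<open>D\<close> demands.\<close>
  have \<mu>_max: "emeasure ?\<mu> {a..} = emeasure ?\<mu> {max a ?m..}"
    by (simp add: emeasure_distr)
      (auto intro!: arg_cong[where f = "emeasure _"] dest: min_error_le)
  have "emeasure ?D {a..} = emeasure D ({?m..1} \<inter> {a..})"
    using sets_D by (subst emeasure_density) (auto simp flip: indicator_inter_arith)
  also have "{?m..1} \<inter> {a..} = {max a ?m..1}"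
    by auto
  \<comment> \<open>If the ray starts beyond 1, both sides measure an empty set, since true errors
    are at most 1.\<close>
  also have "emeasure D {max a ?m..1} = emeasure ?\<mu> {max a ?m..}"
  proof (cases "max a ?m \<le> 1")
    case True
    then show ?thesis
      using D[of "max a ?m - ?m"] by (simp add: emeasure_distr_true_error)
  next
    case False
    then have "true_error P h -` {max a ?m..} \<inter> W = {}"
      using true_error_le_1 by fastforce
    with False show ?thesis by (simp add: emeasure_distr)
  qed
  finally show "emeasure ?\<mu> {a..} = emeasure ?D {a..}"
    using \<mu>_max by simp
qed

text \<open>Change of variables \<open>E = true_error P h w\<close>. Integrability of
  \<open>f\<close> is not asked, as the transfer rules for \<open>distr\<close> and
  \<open>density\<close> need only measurability.\<close>

theorem integral_bad_params_classifier_density: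
  fixes f :: "real \<Rightarrow> real"
  assumes D: "classifier_density P W h D" and "0 \<le> \<epsilon>" and [measurable]: "f \<in> borel_measurable borel"
  shows "(LINT w:bad_params P W h \<epsilon>|lebesgue. f (true_error P h w))
    = (LINT E:{min_error P W h + \<epsilon>..1}|D. f E)"
proof -
  let ?m = "min_error P W h"
  have sets_D [measurable_cong]: "sets D = sets borel"
    using D by (simp add: classifier_density_def)
  have "(LINT w:bad_params P W h \<epsilon>|lebesgue. f (true_error P h w))
      = (\<integral>w. indicator (bad_params P W h \<epsilon>) w * f (true_error P h w) \<partial>lebesgue_on W)"
    by (rule set_integral_on_subset[OF bad_params_subset])
  \<comment> \<open>The upper end 1 costs nothing: on \<open>W\<close> the true error never exceeds
    it.\<close>
  also have "\<dots> = (\<integral>w. indicator {?m + \<epsilon>..1} (true_error P h w) * f (true_error P h w) \<partial>lebesgue_on W)"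
    using true_error_le_1
    by (intro Bochner_Integration.integral_cong refl) (auto simp: indicator_def bad_params_def)
  also have "\<dots> = (\<integral>E. indicator {?m + \<epsilon>..1} E * f E \<partial>distr (lebesgue_on W) borel (true_error P h))"
    by (subst integral_distr) auto
  also have "\<dots> = (\<integral>E. indicator {?m + \<epsilon>..1} E * f E \<partial>density D (\<lambda>E. ennreal (indicator {?m..1} E)))"
    by (simp add: classifier_density_eq_distr[OF D] ennreal_indicator)
  also have "\<dots> = (\<integral>E. indicator {?m..1} E * (indicator {?m + \<epsilon>..1} E * f E) \<partial>D)"
    by (subst integral_density) auto
  \<comment> \<open>Since \<epsilon> is non-negative, the smaller interval lies in
    \<open>{?m..1}\<close> and absorbs the cut-off.\<close>
  also have "\<dots> = (LINT E:{?m + \<epsilon>..1}|D. f E)"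
    unfolding set_lebesgue_integral_def
    using \<open>0 \<le> \<epsilon>\<close> by (intro Bochner_Integration.integral_cong) (auto simp: indicator_def)
  finally show ?thesis .
qed

section \<open>The upper bound\<close>

lemma integral_bad_params_le:
  "(LINT w:bad_params P W h \<epsilon>|lebesgue. (1 - true_error P h w) ^ n)
    \<le> bad_volume P W h \<epsilon> * (1 - (min_error P W h + \<epsilon>)) ^ n"
proof -
  let ?A = "bad_params P W h \<epsilon>" and ?c = "(1 - (min_error P W h + \<epsilon>)) ^ n"
  note [measurable] = sets_bad_params_on
  interpret M: finite_measure "lebesgue_on W" by (rule finite_measure_W)
  have pow: "0 \<le> (1 - true_error P h w) ^ n" "(1 - true_error P h w) ^ n \<le> 1" if "w \<in> W" for w
    using that true_error_le_1 true_error_nonneg by (auto intro!: power_le_one)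
  have "(\<integral>w. indicator ?A w * (1 - true_error P h w) ^ n \<partial>lebesgue_on W)
      \<le> (\<integral>w. indicator ?A w * ?c \<partial>lebesgue_on W)"
  proof (rule integral_mono)
    show "integrable (lebesgue_on W) (\<lambda>w. indicator ?A w * (1 - true_error P h w) ^ n)"
      by (intro M.integrable_const_bound[of _ 1]) (use pow in \<open>auto simp: indicator_def\<close>)
    \<comment> \<open>With \<epsilon> arbitrary here, \<open>?c\<close> may be negative or exceed 1,
      hence the bound by its absolute value.\<close>
    show "integrable (lebesgue_on W) (\<lambda>w. indicator ?A w * ?c)"
      by (intro M.integrable_const_bound[of _ "\<bar>?c\<bar>"]) (auto simp: indicator_def)
    \<comment> \<open>On \<open>?A\<close> the base \<open>1 - true_error P h w\<close> is at most
      \<open>1 - (min_error P W h + \<epsilon>)\<close>; it is non-negative because errors are at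
      most 1, so powers preserve the order.\<close>
    show "indicator ?A w * (1 - true_error P h w) ^ n \<le> indicator ?A w * ?c"
      if "w \<in> space (lebesgue_on W)" for w
      using that true_error_le_1
      by (auto simp: indicator_def bad_params_def intro!: power_mono)
  qed
  also have "(\<integral>w. indicator ?A w * ?c \<partial>lebesgue_on W) = bad_volume P W h \<epsilon> * ?c"
    using bad_params_subset[of \<epsilon>]
    by (simp add: bad_volume_def measure_on_subset Int_absorb2)
  finally show ?thesis
    by (simp add: set_integral_on_subset[OF bad_params_subset])
qed

end

theorem theorem1:
  fixes P :: "('x \<times> 'y) measure"
    and W :: "(real ^ 'N) set"
    and h :: "real ^ 'N \<Rightarrow> 'x \<Rightarrow> 'y"
    and D :: "real measure"
    and n :: nat
    and \<epsilon> :: real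
  assumes "prob_space P"
    and "compact W"
    and "emeasure lebesgue W \<noteq> 0"
    and "(\<lambda>(w, (x, y)). loss y (h w x)) \<in> borel_measurable (lebesgue_on W \<Otimes>\<^sub>M P)"
    and "vc_dim (h ` W) < \<infinity>"
    and "set_integrable lebesgue W (true_error P h)"
    and "min_error P W h \<in> true_error P h ` W"
    and "n \<ge> 1"
    and "AE S in training_dist P n. emeasure lebesgue (global_minima W h n S) \<noteq> 0"
    and "classifier_density P W h D"
    and "0 \<le> \<epsilon>"
    and "\<epsilon> \<le> 1 - min_error P W h"
  shows "(\<integral>S. bad_minima_volume P W h \<epsilon> n S \<partial>training_dist P n)
           = (LINT w:bad_params P W h \<epsilon>|lebesgue. (1 - true_error P h w) ^ n)
       \<and> (LINT w:bad_params P W h \<epsilon>|lebesgue. (1 - true_error P h w) ^ n)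
           = (LINT E:{min_error P W h + \<epsilon>..1}|D. (1 - E) ^ n)
       \<and> (LINT E:{min_error P W h + \<epsilon>..1}|D. (1 - E) ^ n)
           \<le> bad_volume P W h \<epsilon> * (1 - (min_error P W h + \<epsilon>)) ^ n"
proof -
  interpret prob_space P by fact
  interpret parametrised_classifier P W h
    using assms by unfold_locales (auto intro: lmeasurable_compact)
  show ?thesis
    using mean_bad_minima_volume[OF \<open>n \<ge> 1\<close>, of \<epsilon>] integral_bad_params_le[of \<epsilon> n]
      integral_bad_params_classifier_density[OF \<open>classifier_density P W h D\<close> \<open>0 \<le> \<epsilon>\<close>, of "\<lambda>E. (1 - E) ^ n"]
    by simp
qed

end
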